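(* Let $\Gamma$ be a reduced graph with maximum degree three. Then $\Gamma$ admits a partial orientation as a quasi-transitive mixed graph if and only if $\Gamma$ contains no copy of $\Pi$ (as a subgraph) and the graph formed by the set of edges of $\Gamma$ that are not contained in any copy of $K_3$ contains no odd cycle.
   Context: In a graph $\Gamma$ of maximum degree three, a vertex $u$ is removable when $u$ has degree two, and its two neighbours are adjacent, both have degree three, and have exactly one common neighbour; $\Gamma$ is reduced if it has no removable vertex. $\Pi$ is the graph on six vertices consisting of a triangle with a pendant edge attached at each of its three vertices. The graph formed from a set $X$ of edges has as vertices the endpoints of edges in $X$ and edge set $X$. A mixed graph has a vertex set, a set of (undirected) edges and a set of arcs, with at most one edge or arc between any pair of vertices. A partial orientation of a graph is a mixed graph obtained by orienting some of its edges as arcs. A $2$-dipath is a directed path $xyz$ consisting of arcs $x\to y$, $y\to z$; it is induced if $x$ and $z$ are not joined by an edge or arc. A mixed graph $H$ is quasi-transitive when (1) it has no induced $2$-dipath and (2) for every edge $xy$ there is $t$ with $xty$ or $ytx$ a $2$-dipath. *)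

theory Defs
  imports Main
begin

record 'a graph =
  verts :: "'a set"
  edges :: "'a set set"

definition simple_graph :: "'a graph \<Rightarrow> bool" where
  "simple_graph G \<longleftrightarrow>
     (\<forall>e \<in> edges G. \<exists>x \<in> verts G. \<exists>y \<in> verts G. x \<noteq> y \<and> e = {x, y})"

definition nbhd :: "'a graph \<Rightarrow> 'a \<Rightarrow> 'a set" where
  "nbhd G v = {w \<in> verts G. {v, w} \<in> edges G}"

definition degree :: "'a graph \<Rightarrow> 'a \<Rightarrow> nat" where
  "degree G v = card (nbhd G v)"

(* Graphs may be infinite; finiteness of neighbourhoods is explicit because
   card is 0 on infinite sets. *)
definition has_max_degree :: "'a graph \<Rightarrow> nat \<Rightarrow> bool" where
  "has_max_degree G k \<longleftrightarrow>
     (\<forall>v \<in> verts G. finite (nbhd G v) \<and> degree G v \<le> k) \<and>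
     (\<exists>v \<in> verts G. degree G v = k)"

definition removable :: "'a graph \<Rightarrow> 'a \<Rightarrow> bool" where
  "removable G u \<longleftrightarrow> u \<in> verts G \<and> degree G u = 2 \<and>
     (\<exists>a b. nbhd G u = {a, b} \<and> {a, b} \<in> edges G \<and>
        degree G a = 3 \<and> degree G b = 3 \<and> card (nbhd G a \<inter> nbhd G b) = 1)"

definition reduced :: "'a graph \<Rightarrow> bool" where
  "reduced G \<longleftrightarrow> (\<forall>u \<in> verts G. \<not> removable G u)"

definition subgraph :: "'a graph \<Rightarrow> 'a graph \<Rightarrow> bool" where
  "subgraph S G \<longleftrightarrow> simple_graph S \<and> verts S \<subseteq> verts G \<and> edges S \<subseteq> edges G"

definition isomorphic :: "'a graph \<Rightarrow> 'b graph \<Rightarrow> bool" where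
  "isomorphic G H \<longleftrightarrow>
     (\<exists>f. bij_betw f (verts G) (verts H) \<and> edges H = (\<lambda>e. f ` e) ` edges G)"

definition copy_in :: "'a graph \<Rightarrow> 'b graph \<Rightarrow> 'a graph \<Rightarrow> bool" where
  "copy_in S H G \<longleftrightarrow> subgraph S G \<and> isomorphic S H"

definition contains_copy :: "'a graph \<Rightarrow> 'b graph \<Rightarrow> bool" where
  "contains_copy G H \<longleftrightarrow> (\<exists>S. copy_in S H G)"

definition K3 :: "nat graph" where
  "K3 = \<lparr>verts = {0, 1, 2}, edges = {{0, 1}, {1, 2}, {0, 2}}\<rparr>"

definition Pi_graph :: "nat graph" where
  "Pi_graph = \<lparr>verts = {0, 1, 2, 3, 4, 5},
     edges = {{0, 1}, {1, 2}, {0, 2}, {0, 3}, {1, 4}, {2, 5}}\<rparr>"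

(* A cycle, hence a simple graph, only for n \<ge> 3. *)
definition cycle_graph :: "nat \<Rightarrow> nat graph" where
  "cycle_graph n = \<lparr>verts = {0..<n}, edges = {{i, (i + 1) mod n} | i. i < n}\<rparr>"

definition contains_odd_cycle :: "'a graph \<Rightarrow> bool" where
  "contains_odd_cycle G \<longleftrightarrow> (\<exists>n \<ge> 3. odd n \<and> contains_copy G (cycle_graph n))"

definition edge_formed_graph :: "'a set set \<Rightarrow> 'a graph" where
  "edge_formed_graph X = \<lparr>verts = \<Union>X, edges = X\<rparr>"

definition non_triangle_edges :: "'a graph \<Rightarrow> 'a set set" where
  "non_triangle_edges G = {e \<in> edges G. \<not> (\<exists>S. copy_in S K3 G \<and> e \<in> edges S)}"

record 'a mixed_graph =
  mverts :: "'a set"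
  medges :: "'a set set"
  marcs :: "('a \<times> 'a) set"

definition mixed_graph :: "'a mixed_graph \<Rightarrow> bool" where
  "mixed_graph H \<longleftrightarrow>
     (\<forall>e \<in> medges H. \<exists>x \<in> mverts H. \<exists>y \<in> mverts H. x \<noteq> y \<and> e = {x, y}) \<and>
     (\<forall>(x, y) \<in> marcs H. x \<in> mverts H \<and> y \<in> mverts H \<and> x \<noteq> y \<and>
        (y, x) \<notin> marcs H \<and> {x, y} \<notin> medges H)"

definition partial_orientation :: "'a mixed_graph \<Rightarrow> 'a graph \<Rightarrow> bool" where
  "partial_orientation H G \<longleftrightarrow> mixed_graph H \<and> mverts H = verts G \<and>
     edges G = medges H \<union> {{x, y} | x y. (x, y) \<in> marcs H}"

definition two_dipath :: "'a mixed_graph \<Rightarrow> 'a \<Rightarrow> 'a \<Rightarrow> 'a \<Rightarrow> bool" where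
  "two_dipath H x y z \<longleftrightarrow>
     distinct [x, y, z] \<and> (x, y) \<in> marcs H \<and> (y, z) \<in> marcs H"

definition joined :: "'a mixed_graph \<Rightarrow> 'a \<Rightarrow> 'a \<Rightarrow> bool" where
  "joined H x y \<longleftrightarrow> {x, y} \<in> medges H \<or> (x, y) \<in> marcs H \<or> (y, x) \<in> marcs H"

definition induced_two_dipath :: "'a mixed_graph \<Rightarrow> 'a \<Rightarrow> 'a \<Rightarrow> 'a \<Rightarrow> bool" where
  "induced_two_dipath H x y z \<longleftrightarrow> two_dipath H x y z \<and> \<not> joined H x z"

definition quasi_transitive :: "'a mixed_graph \<Rightarrow> bool" where
  "quasi_transitive H \<longleftrightarrow>
     (\<forall>x y z. \<not> induced_two_dipath H x y z) \<and>
     (\<forall>x y. {x, y} \<in> medges H \<longrightarrow> (\<exists>t. two_dipath H x t y \<or> two_dipath H y t x))"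

end

theory Submission
  imports Defs
begin

text \<open>
  An edge in no triangle must be an arc, and at an endpoint of such an arc every other arc has to
  point the same way. Hence each vertex on a non-triangle edge is a source or a sink, which
  2-colours the non-triangle edges; in a copy of $\Pi$ the three triangle vertices would have to be
  pairwise of opposite kind.

  Conversely, fix a 2-colouring of the non-triangle edges by sources and sinks. Absence of $\Pi$
  together with reducedness means that no two vertices of a triangle both lie on non-triangle
  edges. Order the vertices linearly: first the sources on non-triangle edges, then the other
  vertices, those of degree three last among them, and finally the sinks on non-triangle edges.
  Orienting every edge upwards can only create an induced 2-dipath inside a diamond ($K_4$ minus an
  edge), between its two tips $c, d$; if $a, b$ are the other two vertices and $c < a < b < d$,
  leaving $cb$ and $ad$ unoriented repairs this, since $cab$ and $abd$ are then 2-dipaths.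
\<close>

section \<open>Copies as embeddings\<close>

lemma simple_graph_edgeE:
  assumes "simple_graph G" and "e \<in> edges G"
  obtains x y where "x \<in> verts G" "y \<in> verts G" "x \<noteq> y" "e = {x, y}"
  using assms(1)[unfolded simple_graph_def, rule_format, OF assms(2)] that by metis

text \<open>The embedding is the inverse of the isomorphism from \<open>S\<close> to
  \<open>H\<close>, and conversely. Edges of a simple graph lie inside its vertex set, so a
  bijection of the vertices and its inverse also cancel on edges.\<close>

lemma copy_in_iff_embedding:
  assumes "simple_graph H"
  shows "copy_in S H G \<longleftrightarrow> (\<exists>g. inj_on g (verts H) \<and> verts S = g ` verts H \<and>
    edges S = (`) g ` edges H \<and> verts S \<subseteq> verts G \<and> edges S \<subseteq> edges G)"
proof
  assume "copy_in S H G"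
  then obtain f where S: "simple_graph S" "verts S \<subseteq> verts G" "edges S \<subseteq> edges G"
    and f: "bij_betw f (verts S) (verts H)" and eH: "edges H = (`) f ` edges S"
    unfolding copy_in_def subgraph_def isomorphic_def by auto
  define g where "g = the_inv_into (verts S) f"
  have g: "bij_betw g (verts H) (verts S)"
    unfolding g_def by (rule bij_betw_the_inv_into[OF f])
  have "g ` f ` e = e" if "e \<in> edges S" for e
  proof -
    have "e \<subseteq> verts S" using simple_graph_edgeE[OF S(1) that] by auto
    then have "\<forall>x\<in>e. g (f x) = x"
      using f unfolding g_def bij_betw_def by (auto intro: the_inv_into_f_f)
    then show ?thesis by (simp add: image_image)
  qed
  then have "edges S = (`) g ` edges H" unfolding eH by (simp add: image_image)
  then show "\<exists>g. inj_on g (verts H) \<and> verts S = g ` verts H \<and>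
    edges S = (`) g ` edges H \<and> verts S \<subseteq> verts G \<and> edges S \<subseteq> edges G"
    using g S unfolding bij_betw_def by (intro exI[of _ g]) auto
next
  assume "\<exists>g. inj_on g (verts H) \<and> verts S = g ` verts H \<and>
    edges S = (`) g ` edges H \<and> verts S \<subseteq> verts G \<and> edges S \<subseteq> edges G"
  then obtain g where inj: "inj_on g (verts H)" and vS: "verts S = g ` verts H"
    and eS: "edges S = (`) g ` edges H" and sub: "verts S \<subseteq> verts G" "edges S \<subseteq> edges G"
    by (elim exE conjE) (rule that; assumption)
  have "simple_graph S"
    unfolding simple_graph_def
  proof
    fix e assume "e \<in> edges S"
    then obtain d where d: "d \<in> edges H" "e = g ` d" using eS by auto
    obtain x y where "x \<in> verts H" "y \<in> verts H" "x \<noteq> y" "d = {x, y}"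
      using simple_graph_edgeE[OF assms d(1)] .
    then show "\<exists>x\<in>verts S. \<exists>y\<in>verts S. x \<noteq> y \<and> e = {x, y}"
      using inj vS d(2) by (intro bexI[of _ "g x"] bexI[of _ "g y"]) (simp_all add: inj_on_eq_iff)
  qed
  moreover have "isomorphic S H"
    unfolding isomorphic_def
  proof (intro exI conjI)
    let ?f = "the_inv_into (verts H) g"
    show "bij_betw ?f (verts S) (verts H)"
      using inj vS by (intro bij_betw_the_inv_into) (simp add: bij_betw_def)
    have "?f ` g ` e = e" if "e \<in> edges H" for e
    proof -
      have "e \<subseteq> verts H" using simple_graph_edgeE[OF assms that] by auto
      then have "\<forall>x\<in>e. ?f (g x) = x"
        using inj by (auto intro: the_inv_into_f_f)
      then show ?thesis by (simp add: image_image)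
    qed
    then show "edges H = (`) ?f ` edges S" unfolding eS by (simp add: image_image)
  qed
  ultimately show "copy_in S H G" using sub unfolding copy_in_def subgraph_def by blast
qed

lemma contains_copy_iff_embedding:
  assumes "simple_graph H"
  shows "contains_copy G H \<longleftrightarrow>
    (\<exists>g. inj_on g (verts H) \<and> g ` verts H \<subseteq> verts G \<and> (\<forall>e\<in>edges H. g ` e \<in> edges G))"
    (is "_ \<longleftrightarrow> ?emb")
proof
  assume "contains_copy G H"
  then obtain S where "copy_in S H G" unfolding contains_copy_def by blast
  then obtain g where "inj_on g (verts H)" "verts S = g ` verts H"
    "edges S = (`) g ` edges H" "verts S \<subseteq> verts G" "edges S \<subseteq> edges G"
    unfolding copy_in_iff_embedding[OF assms] by (elim exE conjE) (rule that; assumption)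
  then show ?emb by (intro exI[of _ g]) auto
next
  assume ?emb
  then obtain g where "inj_on g (verts H)" "g ` verts H \<subseteq> verts G" "\<forall>e\<in>edges H. g ` e \<in> edges G"
    by blast
  then have "copy_in \<lparr>verts = g ` verts H, edges = (`) g ` edges H\<rparr> H G"
    unfolding copy_in_iff_embedding[OF assms] by auto
  then show "contains_copy G H" unfolding contains_copy_def by blast
qed

section \<open>Translating triangles and copies of \<open>Pi_graph\<close> into adjacency\<close>

definition adj :: "'a graph \<Rightarrow> 'a \<Rightarrow> 'a \<Rightarrow> bool" where
  "adj G x y \<longleftrightarrow> {x, y} \<in> edges G"

lemma adj_sym: "adj G x y \<Longrightarrow> adj G y x"
  unfolding adj_def by (simp add: insert_commute)

lemma adj_irrefl: "simple_graph G \<Longrightarrow> \<not> adj G x x"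
  unfolding adj_def simple_graph_def by (metis insert_absorb2 doubleton_eq_iff)

lemma adj_verts: "simple_graph G \<Longrightarrow> adj G x y \<Longrightarrow> x \<in> verts G \<and> y \<in> verts G"
  unfolding adj_def simple_graph_def by (metis doubleton_eq_iff)

lemma nbhd_eq_Collect_adj: "simple_graph G \<Longrightarrow> nbhd G v = {w. adj G v w}"
  using adj_verts unfolding nbhd_def adj_def by fastforce

text \<open>Stated for a bare relation because the later arguments use adjacency only;
  \<open>mem_non_triangle_edges_iff\<close> links it to copies of \<open>K3\<close>.\<close>

definition nontri :: "('a \<Rightarrow> 'a \<Rightarrow> bool) \<Rightarrow> 'a \<Rightarrow> 'a \<Rightarrow> bool" where
  "nontri E x y \<longleftrightarrow> E x y \<and> \<not> (\<exists>t. E x t \<and> E y t)"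

lemma simple_K3: "simple_graph K3"
  unfolding simple_graph_def K3_def by auto

lemma simple_Pi_graph: "simple_graph Pi_graph"
  unfolding simple_graph_def Pi_graph_def by auto

lemma simple_cycle_graph:
  assumes "n \<ge> 3"
  shows "simple_graph (cycle_graph n)"
  unfolding simple_graph_def
proof
  fix e assume "e \<in> edges (cycle_graph n)"
  then obtain i where i: "i < n" "e = {i, (i + 1) mod n}"
    unfolding cycle_graph_def by auto
  have "i \<noteq> (i + 1) mod n"
    using i(1) assms by (cases "i + 1 = n") auto
  moreover have "i \<in> verts (cycle_graph n)" "(i + 1) mod n \<in> verts (cycle_graph n)"
    using i(1) unfolding cycle_graph_def by auto
  ultimately show "\<exists>x\<in>verts (cycle_graph n). \<exists>y\<in>verts (cycle_graph n). x \<noteq> y \<and> e = {x, y}"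
    using i(2) by metis
qed

lemma mem_non_triangle_edges_iff:
  assumes "simple_graph G"
  shows "{x, y} \<in> non_triangle_edges G \<longleftrightarrow> nontri (adj G) x y"
proof -
  have "(\<exists>S. copy_in S K3 G \<and> {x, y} \<in> edges S) \<longleftrightarrow> (\<exists>t. adj G x t \<and> adj G y t)"
    if xy: "adj G x y"
  proof
    assume "\<exists>S. copy_in S K3 G \<and> {x, y} \<in> edges S"
    then obtain S where S: "copy_in S K3 G" and e: "{x, y} \<in> edges S" by blast
    obtain g where eS: "edges S = (`) g ` edges K3" and sub: "edges S \<subseteq> edges G"
      using S
      unfolding copy_in_iff_embedding[OF simple_K3] by (elim exE conjE) (rule that; assumption)
    have "edges S = {{g 0, g 1}, {g 1, g 2}, {g 0, g 2}}"
      unfolding eS K3_def by simp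
    then have "adj G (g 0) (g 1)" "adj G (g 1) (g 2)" "adj G (g 0) (g 2)"
      and "{x, y} \<in> {{g 0, g 1}, {g 1, g 2}, {g 0, g 2}}"
      using sub e unfolding adj_def by auto
    then show "\<exists>t. adj G x t \<and> adj G y t"
      using adj_sym[of G] by (auto simp: doubleton_eq_iff)
  next
    assume "\<exists>t. adj G x t \<and> adj G y t"
    then obtain t where t: "adj G x t" "adj G y t" by blast
    define g :: "nat \<Rightarrow> 'a" where "g = (\<lambda>i. if i = 0 then x else if i = 1 then y else t)"
    have ne: "x \<noteq> y" "x \<noteq> t" "y \<noteq> t" using xy t adj_irrefl[OF assms] by auto
    have "copy_in \<lparr>verts = g ` verts K3, edges = (`) g ` edges K3\<rparr> K3 G"
      unfolding copy_in_iff_embedding[OF simple_K3]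
      using ne xy t adj_verts[OF assms]
      by (intro exI[of _ g]) (auto simp: K3_def g_def inj_on_def adj_def insert_commute)
    moreover have "{x, y} \<in> (`) g ` edges K3" by (auto simp: K3_def g_def)
    ultimately show "\<exists>S. copy_in S K3 G \<and> {x, y} \<in> edges S" by force
  qed
  then show ?thesis unfolding non_triangle_edges_def nontri_def adj_def by blast
qed

lemma contains_Pi_iff:
  assumes "simple_graph G"
  shows "contains_copy G Pi_graph \<longleftrightarrow>
    (\<exists>a b c a' b' c'. distinct [a, b, c, a', b', c'] \<and> adj G a b \<and> adj G b c \<and> adj G a c \<and>
      adj G a a' \<and> adj G b b' \<and> adj G c c')"
    (is "_ \<longleftrightarrow> ?R")
proof
  assume "contains_copy G Pi_graph"
  then obtain g :: "nat \<Rightarrow> 'a" where inj: "inj_on g (verts Pi_graph)"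
    and e: "\<forall>e\<in>edges Pi_graph. g ` e \<in> edges G"
    unfolding contains_copy_iff_embedding[OF simple_Pi_graph] by (elim exE conjE) (rule that; assumption)
  have "distinct (map g [0, 1, 2, 3, 4, 5])"
    unfolding distinct_map using inj by (simp add: Pi_graph_def)
  then have "distinct [g 0, g 1, g 2, g 3, g 4, g 5]" by simp
  moreover have "adj G (g 0) (g 1)" "adj G (g 1) (g 2)" "adj G (g 0) (g 2)"
    "adj G (g 0) (g 3)" "adj G (g 1) (g 4)" "adj G (g 2) (g 5)"
    using e unfolding Pi_graph_def adj_def by simp_all
  ultimately show ?R by blast
next
  assume ?R
  then obtain a b c a' b' c' where d: "distinct [a, b, c, a', b', c']"
    and e: "adj G a b" "adj G b c" "adj G a c" "adj G a a'" "adj G b b'" "adj G c c'" by blast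
  let ?g = "\<lambda>i. [a, b, c, a', b', c'] ! i"
  have "inj_on ?g (verts Pi_graph)"
    using d unfolding Pi_graph_def inj_on_def by (auto simp: eval_nat_numeral)
  moreover have "?g ` verts Pi_graph \<subseteq> verts G"
    using e adj_verts[OF assms] unfolding Pi_graph_def by (auto simp: eval_nat_numeral)
  moreover have "\<forall>e\<in>edges Pi_graph. ?g ` e \<in> edges G"
    using e unfolding Pi_graph_def adj_def by (auto simp: eval_nat_numeral)
  ultimately show "contains_copy G Pi_graph"
    unfolding contains_copy_iff_embedding[OF simple_Pi_graph] by (intro exI[of _ ?g]) simp
qed

section \<open>Odd cycles and 2-colourings\<close>

definition closed_walk :: "('a \<Rightarrow> 'a \<Rightarrow> bool) \<Rightarrow> (nat \<Rightarrow> 'a) \<Rightarrow> nat \<Rightarrow> bool" where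
  "closed_walk E f n \<longleftrightarrow> f n = f 0 \<and> (\<forall>i<n. E (f i) (f (Suc i)))"

text \<open>A shortest odd closed walk repeats no vertex: a repetition splits it into two shorter
  closed walks, and one of these is odd.\<close>

lemma odd_closed_walk_imp_odd_cycle:
  assumes "closed_walk E f n" and "odd n"
  obtains g m where "closed_walk E g m" "odd m" "inj_on g {0..<m}"
proof -
  define m where "m = (LEAST m. odd m \<and> (\<exists>g. closed_walk E g m))"
  have "odd m \<and> (\<exists>g. closed_walk E g m)"
    unfolding m_def using assms by (intro LeastI) blast
  then obtain g where m: "odd m" and g: "closed_walk E g m" by blast
  have min: "m \<le> k" if "odd k" "closed_walk E h k" for h k
    unfolding m_def using that by (intro Least_le) blast
  have False if "i < j" "j < m" "g i = g j" for i j
  proof (cases "odd (j - i)")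
    case True
    have "closed_walk E (\<lambda>k. g (i + k)) (j - i)"
      using g that unfolding closed_walk_def by simp
    from min[OF True this] show False using that by linarith
  next
    case False
    \<comment> \<open>The walk with the even segment between positions \<open>i\<close> and
      \<open>j\<close> cut out.\<close>
    let ?h = "\<lambda>k. if k \<le> i then g k else g (k + (j - i))"
    have "closed_walk E ?h (m - (j - i))"
      unfolding closed_walk_def
    proof (intro conjI allI impI)
      show "?h (m - (j - i)) = ?h 0"
        using g that unfolding closed_walk_def by auto
      fix k assume k: "k < m - (j - i)"
      consider "k < i" | "k = i" | "k > i" by linarith
      then show "E (?h k) (?h (Suc k))"
      proof cases
        case 1
        then show ?thesis using g that unfolding closed_walk_def by simp
      next
        case 2
        then have "?h k = g j" "?h (Suc k) = g (Suc j)" using that by auto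
        then show ?thesis using g that unfolding closed_walk_def by simp
      next
        case 3
        then show ?thesis using g k unfolding closed_walk_def by simp
      qed
    qed
    moreover have "odd (m - (j - i))" using m False that by simp
    ultimately have "m \<le> m - (j - i)" using min by blast
    then show False using that by linarith
  qed
  then have "inj_on g {0..<m}"
    unfolding inj_on_def by (metis atLeastLessThan_iff linorder_neqE_nat)
  then show thesis using that m g by blast
qed

lemma closed_walk_odd_not_2_coloured:
  assumes "closed_walk E f n" and "odd n" and "\<And>x y. E x y \<Longrightarrow> c x \<noteq> (c y :: bool)"
  shows False
proof -
  have "i \<le> n \<Longrightarrow> c (f i) = (c (f 0) = even i)" for i
  proof (induction i)
    case (Suc i)
    then have "E (f i) (f (Suc i))" using assms(1) unfolding closed_walk_def by simp
    from assms(3)[OF this] Suc show ?case by auto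
  qed simp
  from this[of n] show False using assms(1,2) unfolding closed_walk_def by simp
qed

lemma relpowp_imp_walk:
  assumes "(E ^^ n) x y"
  obtains f where "f 0 = x" "f n = y" "\<And>i. i < n \<Longrightarrow> E (f i) (f (Suc i))"
  using assms unfolding relpowp_fun_conv by blast

text \<open>Each vertex is coloured by the parity of a walk from a chosen root of its component.
  This works for infinite graphs as well.\<close>

lemma two_colourable_if_no_odd_closed_walk:
  assumes sym: "\<And>x y. E x y \<Longrightarrow> E y x"
    and odd: "\<And>f n. closed_walk E f n \<Longrightarrow> odd n \<Longrightarrow> False"
  shows "\<exists>c :: 'a \<Rightarrow> bool. \<forall>x y. E x y \<longrightarrow> c x \<noteq> c y"
proof -
  have rev: "(E ^^ n) y x" if "(E ^^ n) x y" for n x y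
    using that
  proof (induction n arbitrary: y)
    case (Suc n)
    then obtain z where "(E ^^ n) x z" "E z y" by auto
    then have "(E ^^ n) z x" "E y z" using Suc.IH sym by auto
    then show ?case by (rule_tac relpowp_Suc_I2)
  qed auto
  define r where "r x = (SOME z. \<exists>n. (E ^^ n) z x)" for x
  have r: "\<exists>n. (E ^^ n) (r x) x" for x
    unfolding r_def by (rule someI[of _ x]) (auto intro: exI[of _ 0])
  have step: "(E ^^ Suc n) z y" if "(E ^^ n) z x" "E x y" for n x y z
    using that by auto
  have r_eq: "r x = r y" if "E x y" for x y
  proof -
    \<comment> \<open>Adjacent vertices are reachable from the same vertices, so the choice operator
      is applied to the same predicate and returns the same root.\<close>
    have "(\<exists>n. (E ^^ n) z x) \<longleftrightarrow> (\<exists>n. (E ^^ n) z y)" for z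
      using step that sym by blast
    then show ?thesis unfolding r_def by simp
  qed
  define c where "c x = (\<exists>n. even n \<and> (E ^^ n) (r x) x)" for x
  \<comment> \<open>Two walks of different parity with common endpoints would join, one of them
    reversed, to an odd closed walk.\<close>
  have par: "even m = even n" if "(E ^^ m) z x" "(E ^^ n) z x" for m n x z
  proof (rule ccontr)
    assume "even m \<noteq> even n"
    then have "odd (m + n)" by simp
    have "(E ^^ (m + n)) z z"
      using that(1) rev[OF that(2)] unfolding relpowp_add by blast
    then obtain f where "f 0 = z" "f (m + n) = z" "\<And>i. i < m + n \<Longrightarrow> E (f i) (f (Suc i))"
      by (rule relpowp_imp_walk) blast
    then show False using odd[of f "m + n"] \<open>odd (m + n)\<close> unfolding closed_walk_def by simp
  qed
  have "c x \<noteq> c y" if "E x y" for x y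
  proof -
    obtain n where n: "(E ^^ n) (r x) x" using r by blast
    have n': "(E ^^ Suc n) (r y) y" using step[OF n that] r_eq[OF that] by simp
    have "c x = even n" unfolding c_def using n par by blast
    moreover have "c y = even (Suc n)" unfolding c_def using n' par by blast
    ultimately show ?thesis by simp
  qed
  then show ?thesis by blast
qed

lemma contains_odd_cycle_iff:
  assumes irr: "\<And>x. {x} \<notin> X"
  shows "contains_odd_cycle (edge_formed_graph X) \<longleftrightarrow>
    (\<exists>f n. odd n \<and> closed_walk (\<lambda>x y. {x, y} \<in> X) f n)"
proof
  assume "contains_odd_cycle (edge_formed_graph X)"
  then obtain n g where n: "n \<ge> 3" "odd n"
    and e: "\<forall>e\<in>edges (cycle_graph n). g ` e \<in> edges (edge_formed_graph X)"
    unfolding contains_odd_cycle_def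
    using contains_copy_iff_embedding[OF simple_cycle_graph] by metis
  have "{g i, g (Suc i mod n)} \<in> X" if "i < n" for i
  proof -
    have "{i, (i + 1) mod n} \<in> edges (cycle_graph n)"
      using that unfolding cycle_graph_def by auto
    from e[rule_format, OF this] show ?thesis by (simp add: edge_formed_graph_def)
  qed
  \<comment> \<open>Reducing the index modulo \<open>n\<close> makes position \<open>n\<close>
    coincide with position 0.\<close>
  then have "closed_walk (\<lambda>x y. {x, y} \<in> X) (\<lambda>i. g (i mod n)) n"
    unfolding closed_walk_def by auto
  then show "\<exists>f n. odd n \<and> closed_walk (\<lambda>x y. {x, y} \<in> X) f n" using n(2) by blast
next
  assume "\<exists>f n. odd n \<and> closed_walk (\<lambda>x y. {x, y} \<in> X) f n"
  then obtain f m where "closed_walk (\<lambda>x y. {x, y} \<in> X) f m" "odd m" by blast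
  then obtain g n where g: "closed_walk (\<lambda>x y. {x, y} \<in> X) g n" and n: "odd n"
    and inj: "inj_on g {0..<n}"
    by (rule odd_closed_walk_imp_odd_cycle)
  \<comment> \<open>A closed walk of length one is a loop; with that excluded, oddness forces the
    length at least 3 that a cycle graph needs.\<close>
  have "n \<noteq> 1" using g irr unfolding closed_walk_def by auto
  then have n3: "n \<ge> 3" using n by presburger
  have step: "{g i, g ((i + 1) mod n)} \<in> X" if "i < n" for i
    using g that unfolding closed_walk_def by (cases "i + 1 = n") auto
  have "contains_copy (edge_formed_graph X) (cycle_graph n)"
    unfolding contains_copy_iff_embedding[OF simple_cycle_graph[OF n3]]
  proof (intro exI conjI)
    show "inj_on g (verts (cycle_graph n))" using inj unfolding cycle_graph_def by simp
    show "g ` verts (cycle_graph n) \<subseteq> verts (edge_formed_graph X)"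
    proof
      fix x assume "x \<in> g ` verts (cycle_graph n)"
      then obtain i where "i < n" "x = g i" unfolding cycle_graph_def by auto
      then show "x \<in> verts (edge_formed_graph X)"
        using step[of i] unfolding edge_formed_graph_def by auto
    qed
    show "\<forall>e\<in>edges (cycle_graph n). g ` e \<in> edges (edge_formed_graph X)"
      using step unfolding cycle_graph_def edge_formed_graph_def by auto
  qed
  then show "contains_odd_cycle (edge_formed_graph X)"
    using n n3 unfolding contains_odd_cycle_def by blast
qed

lemma no_odd_non_triangle_cycle_iff_2_colourable:
  assumes "simple_graph G"
  shows "\<not> contains_odd_cycle (edge_formed_graph (non_triangle_edges G)) \<longleftrightarrow>
    (\<exists>c :: 'a \<Rightarrow> bool. \<forall>x y. nontri (adj G) x y \<longrightarrow> c x \<noteq> c y)"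
proof -
  have irr: "{x} \<notin> non_triangle_edges G" for x
    using mem_non_triangle_edges_iff[OF assms, of x x] adj_irrefl[OF assms]
    unfolding nontri_def by simp
  have E: "(\<lambda>x y. {x, y} \<in> non_triangle_edges G) = nontri (adj G)"
    using mem_non_triangle_edges_iff[OF assms] by (intro ext)
  have iff: "contains_odd_cycle (edge_formed_graph (non_triangle_edges G)) \<longleftrightarrow>
    (\<exists>f n. odd n \<and> closed_walk (nontri (adj G)) f n)"
    using contains_odd_cycle_iff[of "non_triangle_edges G", OF irr] unfolding E .
  have sym: "nontri (adj G) y x" if "nontri (adj G) x y" for x y
    using that adj_sym[of G] unfolding nontri_def by blast
  show ?thesis
    unfolding iff
  proof
    assume "\<not> (\<exists>f n. odd n \<and> closed_walk (nontri (adj G)) f n)"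
    then have no: "closed_walk (nontri (adj G)) f n \<Longrightarrow> odd n \<Longrightarrow> False" for f n by blast
    show "\<exists>c :: 'a \<Rightarrow> bool. \<forall>x y. nontri (adj G) x y \<longrightarrow> c x \<noteq> c y"
      by (rule two_colourable_if_no_odd_closed_walk) (fact sym no)+
  next
    assume "\<exists>c :: 'a \<Rightarrow> bool. \<forall>x y. nontri (adj G) x y \<longrightarrow> c x \<noteq> c y"
    then show "\<not> (\<exists>f n. odd n \<and> closed_walk (nontri (adj G)) f n)"
      using closed_walk_odd_not_2_coloured by metis
  qed
qed

section \<open>Quasi-transitive orientations as arc relations\<close>

text \<open>A partial orientation is determined by its arcs: the unoriented edges are the adjacent
  pairs that carry no arc. Asymmetry of \<open>A\<close> makes the three vertices of every 2-dipath
  distinct.\<close>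

definition quasi_transitive_arcs :: "('a \<Rightarrow> 'a \<Rightarrow> bool) \<Rightarrow> ('a \<Rightarrow> 'a \<Rightarrow> bool) \<Rightarrow> bool" where
  "quasi_transitive_arcs E A \<longleftrightarrow>
    (\<forall>x y. A x y \<longrightarrow> E x y \<and> \<not> A y x) \<and>
    (\<forall>x y z. A x y \<and> A y z \<longrightarrow> E x z) \<and>
    (\<forall>x y. E x y \<and> \<not> A x y \<and> \<not> A y x \<longrightarrow> (\<exists>t. A x t \<and> A t y \<or> A y t \<and> A t x))"

lemma quasi_transitive_arcsD:
  assumes "quasi_transitive_arcs E A"
  shows "A x y \<Longrightarrow> E x y \<and> \<not> A y x"
    and "A x y \<Longrightarrow> A y z \<Longrightarrow> E x z"
    and "E x y \<Longrightarrow> \<not> A x y \<Longrightarrow> \<not> A y x \<Longrightarrow> \<exists>t. A x t \<and> A t y \<or> A y t \<and> A t x"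
  using assms unfolding quasi_transitive_arcs_def by meson+

lemma quasi_transitive_orientation_iff:
  assumes "simple_graph G"
  shows "(\<exists>H. partial_orientation H G \<and> quasi_transitive H) \<longleftrightarrow>
    (\<exists>A. quasi_transitive_arcs (adj G) A)"
proof
  assume "\<exists>H. partial_orientation H G \<and> quasi_transitive H"
  then obtain H where mg: "mixed_graph H"
    and eG: "edges G = medges H \<union> {{x, y} | x y. (x, y) \<in> marcs H}"
    and no: "\<And>x y z. \<not> induced_two_dipath H x y z"
    and ed: "\<And>x y. {x, y} \<in> medges H \<Longrightarrow> \<exists>t. two_dipath H x t y \<or> two_dipath H y t x"
    unfolding partial_orientation_def quasi_transitive_def by blast
  have arc: "x \<noteq> y \<and> (y, x) \<notin> marcs H" if "(x, y) \<in> marcs H" for x y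
    using mg that unfolding mixed_graph_def by blast
  have adj: "adj G x y \<longleftrightarrow> joined H x y" for x y
    unfolding adj_def joined_def eG by (auto simp: doubleton_eq_iff)
  have tr: "adj G x z" if "(x, y) \<in> marcs H" "(y, z) \<in> marcs H" for x y z
    using no[of x y z] arc that unfolding adj induced_two_dipath_def two_dipath_def by auto
  have "quasi_transitive_arcs (adj G) (\<lambda>x y. (x, y) \<in> marcs H)"
    unfolding quasi_transitive_arcs_def
  proof (intro conjI allI impI)
    fix x y assume "(x, y) \<in> marcs H"
    then show "adj G x y" "(y, x) \<notin> marcs H" using arc unfolding adj joined_def by auto
  next
    fix x y z assume "(x, y) \<in> marcs H \<and> (y, z) \<in> marcs H"
    then show "adj G x z" using tr by blast
  next
    fix x y assume "adj G x y \<and> (x, y) \<notin> marcs H \<and> (y, x) \<notin> marcs H"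
    then have "{x, y} \<in> medges H" unfolding adj joined_def by blast
    from ed[OF this]
    show "\<exists>t. (x, t) \<in> marcs H \<and> (t, y) \<in> marcs H \<or> (y, t) \<in> marcs H \<and> (t, x) \<in> marcs H"
      unfolding two_dipath_def by blast
  qed
  then show "\<exists>A. quasi_transitive_arcs (adj G) A" by blast
next
  assume "\<exists>A. quasi_transitive_arcs (adj G) A"
  then obtain A where qt: "quasi_transitive_arcs (adj G) A" by blast
  note A = quasi_transitive_arcsD(1)[OF qt] and tr = quasi_transitive_arcsD(2)[OF qt]
    and ed = quasi_transitive_arcsD(3)[OF qt]
  define H where "H = \<lparr>mverts = verts G,
    medges = {{x, y} | x y. adj G x y \<and> \<not> A x y \<and> \<not> A y x}, marcs = {(x, y). A x y}\<rparr>"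
  have ed_H: "{x, y} \<in> medges H \<longleftrightarrow> adj G x y \<and> \<not> A x y \<and> \<not> A y x" for x y
    unfolding H_def using adj_sym[of G] by (auto simp: doubleton_eq_iff)
  have arc_H: "(x, y) \<in> marcs H \<longleftrightarrow> A x y" for x y unfolding H_def by simp
  note irr = adj_irrefl[OF assms] and vts = adj_verts[OF assms]
  have "mixed_graph H"
    unfolding mixed_graph_def
  proof (intro conjI ballI)
    fix e assume "e \<in> medges H"
    then obtain x y where "adj G x y" "e = {x, y}" unfolding H_def by auto
    then show "\<exists>x\<in>mverts H. \<exists>y\<in>mverts H. x \<noteq> y \<and> e = {x, y}"
      using irr[of x] vts[of x y] unfolding H_def
      by (intro bexI[of _ x] bexI[of _ y]) auto
  next
    fix p assume "p \<in> marcs H"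
    then obtain x y where p: "p = (x, y)" "A x y" unfolding H_def by auto
    then show "case p of (x, y) \<Rightarrow> x \<in> mverts H \<and> y \<in> mverts H \<and> x \<noteq> y \<and>
        (y, x) \<notin> marcs H \<and> {x, y} \<notin> medges H"
      using A[of x y] vts[of x y] irr[of x] unfolding ed_H arc_H p
      by (auto simp: ed_H arc_H) (auto simp: H_def)
  qed
  moreover have "edges G = medges H \<union> {{x, y} | x y. (x, y) \<in> marcs H}"
  proof (intro set_eqI)
    fix e
    show "e \<in> edges G \<longleftrightarrow> e \<in> medges H \<union> {{x, y} | x y. (x, y) \<in> marcs H}"
    proof (cases "\<exists>x y. e = {x, y}")
      case True
      then obtain x y where e: "e = {x, y}" by blast
      have "e \<in> {{x, y} | x y. (x, y) \<in> marcs H} \<longleftrightarrow> A x y \<or> A y x"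
        unfolding e arc_H by (auto simp: doubleton_eq_iff)
      then show ?thesis
        using A[of x y] A[of y x] adj_sym[of G y x] ed_H[of x y] unfolding e adj_def by blast
    next
      case False
      then have "e \<notin> edges G" using simple_graph_edgeE[OF assms] by metis
      then show ?thesis using False unfolding H_def by auto
    qed
  qed
  moreover have "quasi_transitive H"
    unfolding quasi_transitive_def
  proof (intro conjI allI impI)
    fix x y z
    show "\<not> induced_two_dipath H x y z"
      using tr[of x y z] unfolding induced_two_dipath_def two_dipath_def joined_def ed_H arc_H
      by blast
  next
    fix x y assume "{x, y} \<in> medges H"
    then have xy: "adj G x y" "\<not> A x y" "\<not> A y x" unfolding ed_H by auto
    then obtain t where "A x t \<and> A t y \<or> A y t \<and> A t x" using ed by blast
    moreover from this have "distinct [x, t, y]"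
      using A irr xy by auto
    ultimately show "\<exists>t. two_dipath H x t y \<or> two_dipath H y t x"
      unfolding two_dipath_def arc_H by auto
  qed
  ultimately show "\<exists>H. partial_orientation H G \<and> quasi_transitive H"
    unfolding partial_orientation_def by (intro exI[of _ H]) (auto simp: H_def)
qed


section \<open>Necessity of the two conditions\<close>

text \<open>The edge is an arc, and its tail has the required outgoing arc. A non-triangle arc
  leaving the head would form a 2-dipath with it, whose endpoints are then adjacent, so the edge
  would lie in a triangle.\<close>

lemma quasi_transitive_arcs_imp_2_coloured:
  assumes "quasi_transitive_arcs E A" and sym: "\<And>x y. E x y \<Longrightarrow> E y x"
    and xy: "nontri E x y"
  shows "(\<exists>z. A x z \<and> nontri E x z) \<noteq> (\<exists>z. A y z \<and> nontri E y z)"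
proof -
  note A = quasi_transitive_arcsD[OF assms(1)]
  have arc: "A u v \<or> A v u" if "nontri E u v" for u v
    using A(1,3) that sym unfolding nontri_def by meson
  have no: False if "nontri E u v" "A w u" "A u v" for u v w
    using that A(1,2) sym unfolding nontri_def by meson
  have nsym: "nontri E v u" if "nontri E u v" for u v
    using that sym unfolding nontri_def by blast
  show ?thesis using arc[OF xy] no nsym xy by blast
qed

text \<open>By the degree bound the pendant edges lie in no triangle, so each of \<open>a\<close>,
  \<open>b\<close>, \<open>c\<close> is a source or a sink. Adjacent ones must differ in kind, which
  is impossible for three vertices and two kinds.\<close>

lemma quasi_transitive_arcs_imp_no_Pi:
  assumes qt: "quasi_transitive_arcs E A"
    and sym: "\<And>x y. E x y \<Longrightarrow> E y x" and irr: "\<And>x. \<not> E x x"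
    and deg: "\<And>v a b c d. E v a \<Longrightarrow> E v b \<Longrightarrow> E v c \<Longrightarrow> E v d \<Longrightarrow> distinct [a, b, c] \<Longrightarrow> d \<in> {a, b, c}"
    and Pi: "distinct [a, b, c, a', b', c']" "E a b" "E b c" "E a c" "E a a'" "E b b'" "E c c'"
  shows False
proof -
  note A = quasi_transitive_arcsD[OF qt]
  define src where "src v = (\<exists>z. A v z \<and> nontri E v z)" for v
  have nbrs: "E a z \<longleftrightarrow> z \<in> {b, c, a'}" "E b z \<longleftrightarrow> z \<in> {a, c, b'}" "E c z \<longleftrightarrow> z \<in> {a, b, c'}" for z
    using deg[of a b c a' z] deg[of b a c b' z] deg[of c a b c' z] Pi sym by auto
  have "\<not> E a' b" "\<not> E a' c" "\<not> E b' a" "\<not> E b' c" "\<not> E c' a" "\<not> E c' b"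
    using sym[of a' b] sym[of a' c] sym[of b' a] sym[of b' c] sym[of c' a] sym[of c' b] Pi(1)
    unfolding nbrs by auto
  then have non: "nontri E a a'" "nontri E b b'" "nontri E c c'"
    using Pi(5-7) irr unfolding nontri_def nbrs by auto
  have arc: "A u v \<or> A v u" if "nontri E u v" for u v
    using A(1,3) that sym unfolding nontri_def by meson
  \<comment> \<open>The edge \<open>u w\<close> may lie in a triangle: the single non-triangle edge
    at \<open>u\<close> fixes the direction of every arc at \<open>u\<close>.\<close>
  have in_out: "src u \<and> \<not> A w u \<or> \<not> src u \<and> \<not> A u w" if "nontri E u v" "E u w" for u v w
  proof (cases "A u v")
    case True
    then have "\<not> A w u" using that A(1,2) sym unfolding nontri_def by meson
    then show ?thesis using True that unfolding src_def by blast
  next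
    case False
    then have vu: "A v u" using arc[OF that(1)] by blast
    have "\<not> A u w" using vu that A(1,2) sym unfolding nontri_def by meson
    moreover have "\<not> src u"
      using vu that A(1,2) sym unfolding nontri_def src_def by meson
    ultimately show ?thesis by blast
  qed
  have "src u \<noteq> src v" if uv: "E u v" and u: "nontri E u u'" and v: "nontri E v v'"
    for u v u' v'
  proof
    assume eq: "src u = src v"
    \<comment> \<open>Vertices of equal kind have no arc between them, and no 2-dipath joins them
      either, since it would leave one and enter the other.\<close>
    have "\<not> A u v" "\<not> A v u"
      using in_out[OF u uv] in_out[OF v sym[OF uv]] eq by blast+
    then obtain t where t: "A u t \<and> A t v \<or> A v t \<and> A t u" using A(3) uv by blast
    then have "E u t" "E v t" using A(1) sym by blast+
    then show False using in_out[OF u, of t] in_out[OF v, of t] t eq by blast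
  qed
  then have "src a \<noteq> src b" "src b \<noteq> src c" "src a \<noteq> src c"
    using Pi non by blast+
  then show False by blast
qed

section \<open>Orienting a 2-coloured graph\<close>

text \<open>The predicate \<open>s\<close> marks the intended sources among the vertices on
  non-triangle edges. Reducedness and the absence of \<open>Pi_graph\<close> enter only through
  \<open>triangle_one_exit\<close>.\<close>

locale coloured_reduced_graph =
  fixes E :: "'a \<Rightarrow> 'a \<Rightarrow> bool" and s :: "'a \<Rightarrow> bool"
  assumes sym: "E x y \<Longrightarrow> E y x" and irrefl: "\<not> E x x"
    and deg: "\<lbrakk>E v a; E v b; E v c; E v d; distinct [a, b, c]\<rbrakk> \<Longrightarrow> d \<in> {a, b, c}"
    and triangle_one_exit: "\<lbrakk>E x y; E x t; E y t; nontri E x x'; nontri E y y'\<rbrakk> \<Longrightarrow> False"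
    and colour: "nontri E x y \<Longrightarrow> s x \<noteq> s y"
begin

definition exits :: "'a \<Rightarrow> bool" where
  "exits v \<longleftrightarrow> (\<exists>w. nontri E v w)"

definition deg3 :: "'a \<Rightarrow> bool" where
  "deg3 v \<longleftrightarrow> (\<exists>a b c. E v a \<and> E v b \<and> E v c \<and> distinct [a, b, c])"

text \<open>
  Levels 1 and 2 are kept apart so that a tip of degree two of a diamond is comparable in the same
  way with both central vertices, which have level 2.
\<close>

definition level :: "'a \<Rightarrow> nat" where
  "level v = (if exits v then (if s v then 0 else 3) else if deg3 v then 2 else 1)"

text \<open>Ties within a level are broken by an arbitrary well-order, which exists on infinite
  types too.\<close>

definition below :: "'a \<Rightarrow> 'a \<Rightarrow> bool" where
  "below x y \<longleftrightarrow> level x < level y \<or>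
    level x = level y \<and> x \<noteq> y \<and> (x, y) \<in> (SOME r. well_order_on UNIV r)"

lemma below_irrefl: "\<not> below x x"
  unfolding below_def by simp

lemma below_linear: "x \<noteq> y \<Longrightarrow> below x y \<or> below y x"
  and below_trans: "below x y \<Longrightarrow> below y z \<Longrightarrow> below x z"
proof -
  let ?r = "SOME r :: ('a \<times> 'a) set. well_order_on UNIV r"
  have "well_order_on UNIV ?r" by (rule someI_ex) (rule well_order_on)
  then have r: "trans ?r" "antisym ?r" "total ?r"
    unfolding well_order_on_def linear_order_on_def partial_order_on_def preorder_on_def by auto
  show "x \<noteq> y \<Longrightarrow> below x y \<or> below y x"
    using r(3) unfolding below_def total_on_def by auto
  show "below x y \<Longrightarrow> below y z \<Longrightarrow> below x z"
    using r(1,2) unfolding below_def by (auto dest: transD antisymD)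
qed

lemma below_asym: "below x y \<Longrightarrow> \<not> below y x"
  using below_trans below_irrefl by blast

lemma below_level: "below x y \<Longrightarrow> level x \<le> level y"
  unfolding below_def by auto

lemma nontri_sym: "nontri E x y \<Longrightarrow> nontri E y x"
  using sym unfolding nontri_def by blast

text \<open>A vertex on a non-triangle edge is extremal among its neighbours. Along a non-triangle
  edge the neighbour has the other colour, hence the opposite extreme level; along a triangle edge
  the neighbour does not exit and has level 1 or 2.\<close>

lemma exits_same_side:
  assumes "exits y" "E y x" "E y z" "below x y"
  shows "below z y"
proof -
  obtain w where w: "nontri E y w" using assms(1) unfolding exits_def by blast
  have lev: "if s y then level u > level y else level u < level y" if "E y u" for u
  proof (cases "nontri E y u")
    case True
    then have "exits u" using nontri_sym unfolding exits_def by blast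
    then show ?thesis using assms(1) colour[OF True] unfolding level_def by auto
  next
    case False
    then have "\<exists>t. E y t \<and> E u t" using that unfolding nontri_def by blast
    then have "\<not> exits u" using triangle_one_exit[OF that] w unfolding exits_def by blast
    then show ?thesis using assms(1) unfolding level_def by auto
  qed
  have "\<not> s y"
    using lev[OF assms(2)] below_level[OF assms(4)] by (auto split: if_splits)
  then show ?thesis using lev[OF assms(3)] unfolding below_def by simp
qed

text \<open>Since \<open>y\<close> does not exit, both \<open>y x\<close> and \<open>y z\<close> lie
  in triangles. The degree bound at \<open>y\<close> forces these to share their third vertex
  \<open>t\<close>, giving a diamond with tips \<open>x\<close>, \<open>z\<close> and centre
  \<open>y\<close>, \<open>t\<close>.\<close>

lemma diamond:
  assumes "\<not> exits y" "E y x" "E y z" "\<not> E x z" "x \<noteq> z"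
  obtains t where "E x t" "E y t" "E z t"
    "\<forall>u. E y u \<longrightarrow> u \<in> {x, t, z}" "\<forall>u. E t u \<longrightarrow> u \<in> {x, y, z}"
    "deg3 y" "deg3 t" "\<not> exits t"
proof -
  obtain t where t: "E y t" "E x t" using assms(1,2) unfolding exits_def nontri_def by blast
  obtain u where u: "E y u" "E z u" using assms(1,3) unfolding exits_def nontri_def by blast
  have ne: "distinct [x, t, z]" "distinct [x, y, z]"
    using assms t irrefl sym by auto
  have ny: "v \<in> {x, t, z}" if "E y v" for v
    using deg[OF assms(2) t(1) assms(3) that ne(1)] .
  \<comment> \<open>The vertex \<open>u\<close> is not \<open>x\<close>, because \<open>x\<close>
    and \<open>z\<close> are not adjacent, and not \<open>z\<close>, because there are no
    loops.\<close>
  have "u = t" using ny[OF u(1)] u(2) assms irrefl sym by auto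
  then have zt: "E z t" using u by simp
  have nt: "v \<in> {x, y, z}" if "E t v" for v
    using deg[OF sym[OF t(2)] sym[OF t(1)] sym[OF zt] that ne(2)] .
  have "\<not> exits t"
  proof
    assume "exits t"
    then obtain v where v: "nontri E t v" unfolding exits_def by blast
    then have "v \<in> {x, y, z}" using nt unfolding nontri_def by blast
    then show False using v assms t zt sym unfolding nontri_def by blast
  qed
  moreover have "deg3 y" "deg3 t"
    using ne assms(2,3) t zt sym unfolding deg3_def by blast+
  ultimately show thesis
    using that[of t] t zt ny nt by blast
qed

text \<open>
  The edges left unoriented: the pairs $cb$ and $ad$ of a diamond with $c < a < b < d$ and $c$, $d$
  not adjacent.
\<close>

definition bad :: "'a \<Rightarrow> 'a \<Rightarrow> bool" where
  "bad x y \<longleftrightarrow> (\<exists>z. below x z \<and> below z y \<and> E x z \<and> E z y) \<and>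
    ((\<exists>w. below y w \<and> E y w \<and> \<not> E x w) \<or> (\<exists>w. below w x \<and> E w x \<and> \<not> E w y))"

definition arc :: "'a \<Rightarrow> 'a \<Rightarrow> bool" where
  "arc x y \<longleftrightarrow> E x y \<and> below x y \<and> \<not> bad x y"

text \<open>At level 2 the tip would have a third neighbour \<open>w\<close>, and \<open>x w\<close>
  would lie in a triangle. Its third vertex could only be \<open>y\<close> or \<open>t\<close>,
  whose neighbours leave only \<open>w = z\<close>, but \<open>z\<close> is not adjacent to
  \<open>x\<close>. So a tip lies on the same side of both central vertices.\<close>

lemma tip_not_level_2:
  assumes "\<And>u. E y u \<Longrightarrow> u \<in> {x, t, z}" "\<And>u. E t u \<Longrightarrow> u \<in> {x, y, z}"
    "\<not> E x z" "x \<noteq> z" "E x y" "E x t" "y \<noteq> t"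
  shows "level x \<noteq> 2"
proof
  assume "level x = 2"
  then have x: "\<not> exits x" "deg3 x" unfolding level_def by (auto split: if_splits)
  then obtain w where w: "E x w" "w \<noteq> y" "w \<noteq> t"
    unfolding deg3_def by (metis distinct_length_2_or_more)
  then obtain v where v: "E x v" "E w v" using x(1) unfolding exits_def nontri_def by blast
  have "v \<in> {y, t, w}"
    using deg[OF assms(5,6) w(1) v(1)] assms(7) w by simp
  then show False
    using v w assms irrefl sym by (metis insertE singletonD)
qed

text \<open>Otherwise \<open>y\<close> does not exit, since its neighbours lie on both sides of it,
  and \<open>x\<close>, \<open>z\<close> are the tips of a diamond with centre \<open>y\<close>,
  \<open>t\<close>. Levels give \<open>x < t < z\<close>; whichever of \<open>y\<close> and
  \<open>t\<close> comes first, one of the two arcs is \<open>bad\<close>.\<close>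

lemma no_induced_two_dipath:
  assumes "arc x y" "arc y z"
  shows "E x z"
proof (rule ccontr)
  assume xz: "\<not> E x z"
  have a: "E x y" "below x y" "\<not> bad x y" "E y z" "below y z" "\<not> bad y z"
    using assms unfolding arc_def by auto
  have ne: "x \<noteq> z" using a below_asym by blast
  have ny: "\<not> exits y"
    using exits_same_side[of y x z] a sym below_asym by blast
  obtain t where t: "E x t" "E y t" "E z t"
    "\<forall>u. E y u \<longrightarrow> u \<in> {x, t, z}" "\<forall>u. E t u \<longrightarrow> u \<in> {x, y, z}"
    "deg3 y" "deg3 t" "\<not> exits t"
    by (rule diamond[OF ny sym[OF a(1)] a(4) xz ne])
  have yt: "y \<noteq> t" using t irrefl by blast
  have lev: "level y = 2" "level t = 2" using ny t unfolding level_def by auto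
  have "level x \<noteq> 2"
    by (rule tip_not_level_2[of y x t z]) (use t xz ne a yt in auto)
  then have "\<not> below t x" using lev below_level[OF a(2)] below_level[of t x] by auto
  then have xt: "below x t" using below_linear t irrefl by metis
  have "level z \<noteq> 2"
    by (rule tip_not_level_2[of y z t x]) (use t xz ne a yt sym in auto)
  then have "\<not> below z t" using lev below_level[OF a(5)] below_level[of z t] by auto
  then have tz: "below t z" using below_linear t irrefl by metis
  show False
  proof (cases "below t y")
    \<comment> \<open>Here \<open>t\<close> lies between \<open>x\<close> and \<open>y\<close>,
      while \<open>z\<close> is the vertex above \<open>y\<close> not adjacent to
      \<open>x\<close>.\<close>
    case True
    then have "bad x y" using xt a t xz sym unfolding bad_def by blast
    then show False using a by blast
  next
    case False
    then have "below y t" using below_linear yt by blast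
    then have "bad y z" using tz a t xz sym unfolding bad_def by blast
    then show False using a by blast
  qed
qed

text \<open>The witness \<open>z\<close> for \<open>bad x y\<close> is the other central vertex of a
  diamond, and the arcs run through it. Neither half is \<open>bad\<close>, since that needs a
  neighbour of \<open>z\<close> strictly between the ends of that half, and all neighbours of
  \<open>z\<close> are in the diamond.\<close>

lemma bad_imp_two_dipath:
  assumes "bad x y" "E x y"
  shows "\<exists>z. arc x z \<and> arc z y"
proof -
  obtain z where z: "below x z" "below z y" "E x z" "E z y" using assms unfolding bad_def by blast
  note irr = below_irrefl and asym = below_asym
  consider w where "below y w" "E y w" "\<not> E x w" | w where "below w x" "E w x" "\<not> E w y"
    using assms unfolding bad_def by blast
  then show ?thesis
  proof cases
    case 1
    have ne: "x \<noteq> w" using 1 z asym below_trans by blast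
    have ny: "\<not> exits y" using exits_same_side[of y z w] 1 z sym asym by blast
    obtain t where t: "\<forall>u. E y u \<longrightarrow> u \<in> {x, t, w}" "\<forall>u. E t u \<longrightarrow> u \<in> {x, y, w}"
      by (rule diamond[OF ny sym[OF assms(2)] 1(2,3) ne])
    have "z \<in> {x, t, w}" using t(1) sym[OF z(4)] by blast
    then have "z = t" using z 1 irrefl by blast
    have "\<not> bad x z"
    proof
      assume "bad x z"
      then obtain v where v: "below x v" "below v z" "E x v" "E v z" unfolding bad_def by blast
      then have "v \<in> {x, y, w}" using t(2) \<open>z = t\<close> sym by blast
      then show False using v z 1 irr asym by blast
    qed
    moreover have "\<not> bad z y"
    proof
      assume "bad z y"
      then obtain v where v: "below z v" "below v y" "E z v" "E v y" unfolding bad_def by blast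
      then have "v \<in> {x, y, w}" using t(2) \<open>z = t\<close> sym by blast
      then show False using v z 1 irr asym by blast
    qed
    ultimately show ?thesis using z unfolding arc_def by blast
  next
    case 2
    \<comment> \<open>Mirror image of the first case: now \<open>x\<close> and \<open>z\<close> are
      central, the tips are \<open>w\<close> and \<open>y\<close>, and the order is
      \<open>w < x < z < y\<close>.\<close>
    have ne: "w \<noteq> y" using 2 z asym below_trans by blast
    have nx: "\<not> exits x" using exits_same_side[of x w z] 2 z sym asym by blast
    obtain t where t: "\<forall>u. E x u \<longrightarrow> u \<in> {w, t, y}" "\<forall>u. E t u \<longrightarrow> u \<in> {w, x, y}"
      by (rule diamond[OF nx sym[OF 2(2)] assms(2) 2(3) ne])
    have "z \<in> {w, t, y}" using t(1) z(3) by blast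
    then have "z = t" using z 2 irrefl by blast
    have "\<not> bad x z"
    proof
      assume "bad x z"
      then obtain v where v: "below x v" "below v z" "E x v" "E v z" unfolding bad_def by blast
      then have "v \<in> {w, x, y}" using t(2) \<open>z = t\<close> sym by blast
      then show False using v z 2 irr asym by blast
    qed
    moreover have "\<not> bad z y"
    proof
      assume "bad z y"
      then obtain v where v: "below z v" "below v y" "E z v" "E v y" unfolding bad_def by blast
      then have "v \<in> {w, x, y}" using t(2) \<open>z = t\<close> sym by blast
      then show False using v z 2 irr asym by blast
    qed
    ultimately show ?thesis using z unfolding arc_def by blast
  qed
qed

lemma quasi_transitive_arcs_arc: "quasi_transitive_arcs E arc"
  unfolding quasi_transitive_arcs_def
proof (intro conjI allI impI)
  fix x y assume "arc x y"
  then show "E x y" "\<not> arc y x" using below_asym unfolding arc_def by blast+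
next
  fix x y z assume "arc x y \<and> arc y z"
  then show "E x z" using no_induced_two_dipath by blast
next
  fix x y assume xy: "E x y \<and> \<not> arc x y \<and> \<not> arc y x"
  then have "bad x y \<or> bad y x"
    using below_linear irrefl sym unfolding arc_def by metis
  then show "\<exists>t. arc x t \<and> arc t y \<or> arc y t \<and> arc t x"
    using bad_imp_two_dipath xy sym by metis
qed

end

section \<open>Local structure of reduced graphs, and the theorem\<close>

lemma max_degree_3_nbr:
  assumes "simple_graph G" "has_max_degree G 3"
    and "adj G v a" "adj G v b" "adj G v c" "adj G v d" "distinct [a, b, c]"
  shows "d \<in> {a, b, c}"
proof (rule ccontr)
  assume d: "d \<notin> {a, b, c}"
  have "v \<in> verts G" using adj_verts[OF assms(1,3)] by blast
  then have fin: "finite (nbhd G v)" "card (nbhd G v) \<le> 3"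
    using assms(2) unfolding has_max_degree_def degree_def by auto
  have "{a, b, c, d} \<subseteq> nbhd G v"
    using assms(3-6) unfolding nbhd_eq_Collect_adj[OF assms(1)] by auto
  then have "card {a, b, c, d} \<le> 3" using card_mono[OF fin(1)] fin(2) le_trans by blast
  then show False using assms(7) d by auto
qed

text \<open>If \<open>t\<close> has a neighbour outside the triangle, the three outside neighbours
  complete a copy of \<open>Pi_graph\<close>. Otherwise \<open>t\<close> has degree two and is the
  only common neighbour of \<open>x\<close> and \<open>y\<close>, so it is removable.\<close>

lemma triangle_one_exit:
  assumes simple: "simple_graph G" and deg3: "has_max_degree G 3" and red: "reduced G"
    and no_Pi: "\<not> contains_copy G Pi_graph"
    and tri: "adj G x y" "adj G x t" "adj G y t"
    and ex: "nontri (adj G) x x'" "nontri (adj G) y y'"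
  shows False
proof -
  note nbr = max_degree_3_nbr[OF simple deg3] and irr = adj_irrefl[OF simple] and sym = adj_sym[of G]
  have e: "adj G x x'" "adj G y y'" and nx: "\<not> adj G x' y" "\<not> adj G x' t" "\<not> adj G y' x" "\<not> adj G y' t"
    using ex tri sym unfolding nontri_def by blast+
  \<comment> \<open>For instance, \<open>x'\<close> differs from \<open>y'\<close> because
    \<open>x'\<close> is adjacent to \<open>x\<close> and \<open>y'\<close> is not.\<close>
  have d: "distinct [x, y, t, x', y']"
    using e nx tri irr sym by auto
  have Nx: "nbhd G x = {y, t, x'}"
    unfolding nbhd_eq_Collect_adj[OF simple]
    using nbr[OF tri(1,2) e(1)] tri e d by auto
  have Ny: "nbhd G y = {x, t, y'}"
    unfolding nbhd_eq_Collect_adj[OF simple]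
    using nbr[OF sym[OF tri(1)] tri(3) e(2)] tri e d sym by auto
  show False
  proof (cases "\<exists>t'. adj G t t' \<and> t' \<noteq> x \<and> t' \<noteq> y")
    case True
    then obtain t' where t': "adj G t t'" "t' \<noteq> x" "t' \<noteq> y" by blast
    have "distinct [x, y, t, x', y', t']"
      using d t' nx irr sym by auto
    then have "contains_copy G Pi_graph"
      unfolding contains_Pi_iff[OF simple]
      using tri e t'(1)
      by (intro exI[of _ x] exI[of _ y] exI[of _ t] exI[of _ x'] exI[of _ y'] exI[of _ t']) simp
    then show False using no_Pi by blast
  next
    case False
    then have Nt: "nbhd G t = {x, y}"
      unfolding nbhd_eq_Collect_adj[OF simple] using tri sym by auto
    have "nbhd G x \<inter> nbhd G y = {t}" unfolding Nx Ny using d by auto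
    then have "card (nbhd G x \<inter> nbhd G y) = 1" by simp
    moreover have "degree G x = 3" "degree G y = 3" "degree G t = 2"
      unfolding degree_def Nx Ny Nt using d by auto
    moreover have "{x, y} \<in> edges G" "t \<in> verts G"
      using tri(1) adj_verts[OF simple tri(2)] unfolding adj_def by auto
    ultimately have "removable G t" using Nt unfolding removable_def by metis
    then show False using red \<open>t \<in> verts G\<close> unfolding reduced_def by metis
  qed
qed

theorem theorem3p6:
  fixes \<Gamma> :: "'a graph"
  assumes "simple_graph \<Gamma>"
    and "has_max_degree \<Gamma> 3"
    and "reduced \<Gamma>"
  shows "(\<exists>H. partial_orientation H \<Gamma> \<and> quasi_transitive H) \<longleftrightarrow>
         \<not> contains_copy \<Gamma> Pi_graph \<and>
         \<not> contains_odd_cycle (edge_formed_graph (non_triangle_edges \<Gamma>))"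
  unfolding quasi_transitive_orientation_iff[OF assms(1)]
    no_odd_non_triangle_cycle_iff_2_colourable[OF assms(1)]
proof (intro iffI conjI)
  note irr = adj_irrefl[OF assms(1)] and nbr = max_degree_3_nbr[OF assms(1,2)]
  assume "\<exists>A. quasi_transitive_arcs (adj \<Gamma>) A"
  then obtain A where A: "quasi_transitive_arcs (adj \<Gamma>) A" by blast
  show "\<not> contains_copy \<Gamma> Pi_graph"
  proof
    assume "contains_copy \<Gamma> Pi_graph"
    then obtain a b c a' b' c' where "distinct [a, b, c, a', b', c']" "adj \<Gamma> a b" "adj \<Gamma> b c"
      "adj \<Gamma> a c" "adj \<Gamma> a a'" "adj \<Gamma> b b'" "adj \<Gamma> c c'"
      by (auto simp only: contains_Pi_iff[OF assms(1)])
    then show False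
      \<comment> \<open>The rotation moves the four general premises to the end, so that the chained
        facts meet the premises about the copy first.\<close>
      by (rule quasi_transitive_arcs_imp_no_Pi[where E = "adj \<Gamma>" and A = A, rotated 4])
        (fact A adj_sym irr nbr)+
  qed
  define c where "c x = (\<exists>z. A x z \<and> nontri (adj \<Gamma>) x z)" for x
  have "c x \<noteq> c y" if "nontri (adj \<Gamma>) x y" for x y
    unfolding c_def by (rule quasi_transitive_arcs_imp_2_coloured[OF A]) (fact adj_sym that)+
  then show "\<exists>c :: 'a \<Rightarrow> bool. \<forall>x y. nontri (adj \<Gamma>) x y \<longrightarrow> c x \<noteq> c y" by blast
next
  assume R: "\<not> contains_copy \<Gamma> Pi_graph \<and>
    (\<exists>c :: 'a \<Rightarrow> bool. \<forall>x y. nontri (adj \<Gamma>) x y \<longrightarrow> c x \<noteq> c y)"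
  then obtain c :: "'a \<Rightarrow> bool" where c: "\<And>x y. nontri (adj \<Gamma>) x y \<Longrightarrow> c x \<noteq> c y" by blast
  interpret coloured_reduced_graph "adj \<Gamma>" c
    by (unfold_locales; (rule adj_sym adj_irrefl[OF assms(1)] max_degree_3_nbr[OF assms(1,2)] c
        triangle_one_exit[OF assms conjunct1[OF R]]); assumption)
  show "\<exists>A. quasi_transitive_arcs (adj \<Gamma>) A" using quasi_transitive_arcs_arc by blast
qed

end
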